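(* Let $k,w,s,n\in\mathbb Z_{>0}$ with $n\ge wk$. For $g\in\{0,1,\ldots,s-1\}$, \[ \frac{P_{(\delta_{k,g+1}^{(w,s)})'}(\mathbf t_n;0,t)} {P_{(\delta_{k,g}^{(w,s)})'}(\mathbf t_n;0,t)} =t^{\frac{wk(wk-1)}{2}} \begin{cases} \displaystyle \begin{bmatrix}n-wk+w\\ w\end{bmatrix}_t,&g=0,\\[10pt] 1,&1\le g<s. \end{cases} \] Consequently, for $g\in\{1,\ldots,s\}$, \[ \frac{P_{(\delta_{k,g}^{(w,s)})'}(\mathbf t_n;0,t)} {P_{(\delta_k^{(w,s)})'}(\mathbf t_n;0,t)} =t^{\frac{gwk(wk-1)}{2}} \begin{bmatrix}n-wk+w\\ w\end{bmatrix}_t. \]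
   Context: Partitions are weakly decreasing sequences of nonnegative integers with finitely many nonzero parts. The conjugate $\lambda'$ of $\lambda$ is given by $\lambda'_j=|\{i:\lambda_i\ge j\}|$. Exponents on parts denote multiplicities; a part with multiplicity $0$ is omitted. Generalized staircase partitions: for $w,s\in\mathbb Z_{>0}$, $\delta_1^{(w,s)}=\varnothing$ and, for $k\ge2$, $\delta_k^{(w,s)}=\bigl((w(k-1))^s,(w(k-2))^s,\ldots,w^s\bigr)$. Intermediate ones: for $0\le g\le s$, $\delta_{1,g}^{(w,s)}=(w^g)$ (with $\delta_{1,0}^{(w,s)}=\varnothing$) and, for $k\ge2$, $\delta_{k,g}^{(w,s)}=\bigl((wk)^g,(w(k-1))^s,(w(k-2))^s,\ldots,w^s\bigr)$. $P_\lambda(x_1,\ldots,x_n;q,t)$ is the monic Macdonald symmetric polynomial (Macdonald's $P$-normalization), and $P_\lambda(x_1,\ldots,x_n;0,t)$ is its specialization at $q=0$, i.e. the monic Hall--Littlewood polynomial $P_\lambda$; $P_\varnothing=1$. $t$ is an indeterminate and $\mathbf t_n=(1,t,\ldots,t^{n-1})$. With $(a;y)_r=\prod_{i=0}^{r-1}(1-ay^i)$, the Gaussian polynomial for integers $a\ge b\ge0$ is $\begin{bmatrix}a\\ b\end{bmatrix}_t=\frac{(t;t)_a}{(t;t)_b(t;t)_{a-b}}$. *)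

theory Defs
  imports
    "HOL-Library.Poly_Mapping"
    "HOL-Library.More_List"
    "HOL-Combinatorics.Permutations"
    "HOL-Computational_Algebra.Polynomial_Factorial"
begin

section \<open>Partitions\<close>

text \<open>
  A partition \<open>(\<mu>\<^sub>1, \<mu>\<^sub>2, \<dots>)\<close> is a finitely supported weakly decreasing function on
  \<^typ>\<open>nat\<close>, indexed from 0: \<open>\<mu> i\<close> is the part \<open>\<mu>\<^sub>i\<^sub>+\<^sub>1\<close>. A list of parts is turned into
  such a function by padding with zeros.
\<close>

definition partition_of_list :: "nat list \<Rightarrow> nat \<Rightarrow> nat" where
  "partition_of_list xs = nth_default 0 xs"

definition conjugate :: "(nat \<Rightarrow> nat) \<Rightarrow> nat \<Rightarrow> nat" where
  "conjugate \<mu> = (\<lambda>j. card {i. j < \<mu> i})"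

text \<open>The parts \<open>(w(k-1))\<^sup>s, (w(k-2))\<^sup>s, \<dots>, w\<^sup>s\<close>; no parts for \<open>k = 1\<close>.\<close>

definition staircase_parts :: "nat \<Rightarrow> nat \<Rightarrow> nat \<Rightarrow> nat list" where
  "staircase_parts w s k = concat (map (\<lambda>j. replicate s (w * j)) (rev [1..<k]))"

definition staircase :: "nat \<Rightarrow> nat \<Rightarrow> nat \<Rightarrow> nat \<Rightarrow> nat" where
  "staircase w s k = partition_of_list (staircase_parts w s k)"

definition staircase_mid :: "nat \<Rightarrow> nat \<Rightarrow> nat \<Rightarrow> nat \<Rightarrow> nat \<Rightarrow> nat" where
  "staircase_mid w s k g = partition_of_list (replicate g (w * k) @ staircase_parts w s k)"


section \<open>Gaussian polynomials\<close>

definition qpoch :: "'a::comm_ring_1 \<Rightarrow> 'a \<Rightarrow> nat \<Rightarrow> 'a" where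
  "qpoch a y r = (\<Prod>i<r. 1 - a * y ^ i)"

definition gaussian :: "'a::field \<Rightarrow> nat \<Rightarrow> nat \<Rightarrow> 'a" where
  "gaussian t a b = qpoch t t a / (qpoch t t b * qpoch t t (a - b))"


section \<open>Multivariate polynomials\<close>

text \<open>
  Polynomials over \<open>'a\<close> in the variables \<open>x\<^sub>0, x\<^sub>1, \<dots>\<close>: a finitely supported map from monomials
  (exponent vectors) to coefficients. They form an integral domain when \<open>'a\<close> does, so
  \<open>'a mpoly fract\<close> is the field of rational functions.
\<close>

type_synonym 'a mpoly = "(nat \<Rightarrow>\<^sub>0 nat) \<Rightarrow>\<^sub>0 'a"

definition mpoly_const :: "'a::zero \<Rightarrow> 'a mpoly" where
  "mpoly_const c = Poly_Mapping.single 0 c"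

definition mpoly_var :: "nat \<Rightarrow> 'a::zero_neq_one mpoly" where
  "mpoly_var i = Poly_Mapping.single (Poly_Mapping.single i 1) 1"

definition mpoly_eval :: "(nat \<Rightarrow> 'a::comm_semiring_1) \<Rightarrow> 'a mpoly \<Rightarrow> 'a" where
  "mpoly_eval x p =
     (\<Sum>m\<in>Poly_Mapping.keys p. Poly_Mapping.lookup p m *
        (\<Prod>i\<in>Poly_Mapping.keys m. x i ^ Poly_Mapping.lookup m i))"


section \<open>Hall--Littlewood polynomials\<close>

text \<open>
  The Macdonald polynomial \<open>P\<^sub>\<mu>(x\<^sub>1, \<dots>, x\<^sub>n; 0, t)\<close> at \<open>q = 0\<close> is the Hall--Littlewood polynomial
  \<open>P\<^sub>\<mu>(x\<^sub>1, \<dots>, x\<^sub>n; t)\<close>, which is given (Macdonald, Symmetric Functions and Hall Polynomials,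
  III.2) by
  \[
    P_\mu = \frac{1}{v_\mu(t)} \sum_{\sigma \in S_n}
      \sigma\Bigl(x_1^{\mu_1} \cdots x_n^{\mu_n}
        \prod_{i<j} \frac{x_i - t x_j}{x_i - x_j}\Bigr),
  \]
  where \<open>v\<^sub>m(t) = (1 - t)\<dots>(1 - t\<^sup>m) / (1 - t)\<^sup>m\<close> and \<open>v\<^sub>\<mu>(t)\<close> is the product of \<open>v\<^sub>m(t)\<close> over
  the multiplicities \<open>m\<close> of the distinct entries of \<open>(\<mu>\<^sub>1, \<dots>, \<mu>\<^sub>n)\<close>, the entry 0 included.
  Division by \<open>v\<^sub>\<mu>(t)\<close> makes the coefficient of \<open>x\<^sup>\<mu>\<close> equal to 1. The symmetrization is a sum of
  rational functions; \<open>hall_littlewood\<close> is the polynomial it is equal to.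
  As usual, \<open>P\<^sub>\<mu>\<close> in \<open>n\<close> variables is 0 if \<open>\<mu>\<close> has more than \<open>n\<close> parts.
\<close>

definition hl_v :: "'a::field \<Rightarrow> nat \<Rightarrow> 'a" where
  "hl_v t m = (\<Prod>i=1..m. (1 - t ^ i) / (1 - t))"

definition hl_v_partition :: "nat \<Rightarrow> (nat \<Rightarrow> nat) \<Rightarrow> 'a::field \<Rightarrow> 'a" where
  "hl_v_partition n \<mu> t = (\<Prod>a\<in>\<mu> ` {..<n}. hl_v t (card {i. i < n \<and> \<mu> i = a}))"

definition hl_symmetrization :: "nat \<Rightarrow> (nat \<Rightarrow> nat) \<Rightarrow> 'a::field \<Rightarrow> (nat \<Rightarrow> 'a) \<Rightarrow> 'a" where
  "hl_symmetrization n \<mu> t x =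
     (\<Sum>\<sigma> | \<sigma> permutes {..<n}.
        (\<Prod>i<n. x (\<sigma> i) ^ \<mu> i) *
        (\<Prod>j<n. \<Prod>i<j. (x (\<sigma> i) - t * x (\<sigma> j)) / (x (\<sigma> i) - x (\<sigma> j))))
     / hl_v_partition n \<mu> t"

definition hall_littlewood :: "nat \<Rightarrow> (nat \<Rightarrow> nat) \<Rightarrow> 'a::field \<Rightarrow> 'a mpoly" where
  "hall_littlewood n \<mu> t =
     (if \<mu> n = 0
      then THE p. to_fract p =
             hl_symmetrization n \<mu> (to_fract (mpoly_const t)) (\<lambda>i. to_fract (mpoly_var i))
      else 0)"

text \<open>The indeterminate \<open>t\<close> of the field of rational functions over the rationals.\<close>

definition indet_t :: "rat poly fract" where
  "indet_t = to_fract [:0, 1:]"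

text \<open>\<open>P\<^sub>\<mu>(1, t, \<dots>, t\<^sup>n\<^sup>-\<^sup>1; 0, t)\<close>\<close>

definition P_spec :: "nat \<Rightarrow> (nat \<Rightarrow> nat) \<Rightarrow> rat poly fract" where
  "P_spec n \<mu> = mpoly_eval (\<lambda>i. indet_t ^ i) (hall_littlewood n \<mu> indet_t)"

end

theory Submission
  imports Defs
begin

text \<open>
The idea is to evaluate each Hall--Littlewood polynomial at \<open>(1, t, \<dots>, t\<^sup>n\<^sup>-\<^sup>1)\<close> from its definition
as a sum over \<open>S\<^sub>n\<close>. At this point the factor \<open>x\<^sub>\<sigma>\<^sub>(\<^sub>i\<^sub>) - t x\<^sub>\<sigma>\<^sub>(\<^sub>j\<^sub>)\<close> with \<open>i < j\<close> vanishes as soon as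
\<open>\<sigma> i = \<sigma> j + 1\<close>, and the identity is the only permutation that avoids this for every pair
(\<open>permutes_eq_id_if_no_descent\<close>). The one surviving term gives
\[
  P_\mu(1, t, \dots, t^{n-1}; 0, t) = t^{n(\mu)} \frac{v_n(t)}{v_\mu(t)},
  \qquad n(\mu) = \sum_{i \ge 1} (i - 1) \mu_i
\]
(\<open>hall_littlewood_principal_specialization\<close>).

Evaluating term by term is legitimate only once the symmetrization, a sum of rational functions, is
known to be a polynomial. Over the common denominator, the Vandermonde product \<open>\<Delta>\<close>, its numerator
is the antisymmetrization of a polynomial. It vanishes when two variables are identified, so every
\<open>x\<^sub>a - x\<^sub>b\<close> divides it; these factors stay nonzero when a different pair of variables is identified,
so their product \<open>\<Delta>\<close> divides it too (\<open>vandermonde_dvd_antisymmetrization\<close>). The resulting polynomial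
identity, numerator \<open>=\<close> \<open>\<Delta> v\<^sub>\<mu> P\<^sub>\<mu>\<close>, can be evaluated at the distinct points \<open>t\<^sup>i\<close>.

It remains to compare \<open>n(\<mu>)\<close> and \<open>v\<^sub>\<mu>\<close> along the staircases. Adding a part \<open>wk\<close> to a partition
raises each of the first \<open>wk\<close> parts of its conjugate by 1, so \<open>n(\<mu>)\<close> grows by
\<open>0 + 1 + \<dots> + (wk - 1)\<close>, which is the power of \<open>t\<close> in the theorem. The conjugate itself consists of
\<open>k\<close> blocks of \<open>w\<close> equal parts followed by \<open>n - wk\<close> zeros; for \<open>g > 0\<close> the blocks are distinct and
nonzero, whereas for \<open>g = 0\<close> the last block is zero and merges with the zeros. Hence \<open>v\<^sub>\<mu>\<close> changes
only between \<open>g = 0\<close> and \<open>g = 1\<close>, by the factor \<open>v\<^sub>w v\<^sub>n\<^sub>-\<^sub>w\<^sub>k / v\<^sub>n\<^sub>-\<^sub>w\<^sub>k\<^sub>+\<^sub>w\<close>, the inverse of the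
Gaussian polynomial (\<open>gaussian_eq_hl_v\<close>).
\<close>

section \<open>Evaluation homomorphisms of multivariate polynomials\<close>

text \<open>
Two kinds of evaluation are needed: at scalars, with coefficients left as they are, and at
polynomials, with coefficients embedded as constants. Both are the evaluation homomorphism extending
a ring homomorphism \<open>h\<close> of the coefficients.
\<close>

locale coeff_hom =
  fixes h :: "'a::comm_ring_1 \<Rightarrow> 'b::comm_ring_1"
  assumes hom_add: "h (a + b) = h a + h b"
    and hom_mult: "h (a * b) = h a * h b"
    and hom_one: "h 1 = 1"
begin

lemma hom_zero: "h 0 = 0"
  using hom_add[of 0 0] by simp

definition monom_eval :: "(nat \<Rightarrow> 'b) \<Rightarrow> (nat \<Rightarrow>\<^sub>0 nat) \<Rightarrow> 'b" where
  "monom_eval x m = (\<Prod>i\<in>Poly_Mapping.keys m. x i ^ Poly_Mapping.lookup m i)"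

definition meval :: "(nat \<Rightarrow> 'b) \<Rightarrow> 'a mpoly \<Rightarrow> 'b" where
  "meval x p = (\<Sum>m\<in>Poly_Mapping.keys p. h (Poly_Mapping.lookup p m) * monom_eval x m)"

text \<open>
Sums and products over the support are awkward when two supports have to be compared; any larger
finite index set gives the same value.
\<close>

lemma monom_eval_superset:
  assumes "finite S" "Poly_Mapping.keys m \<subseteq> S"
  shows "monom_eval x m = (\<Prod>i\<in>S. x i ^ Poly_Mapping.lookup m i)"
  unfolding monom_eval_def
  by (rule prod.mono_neutral_left) (use assms in \<open>auto simp: in_keys_iff\<close>)

lemma monom_eval_add: "monom_eval x (m + m') = monom_eval x m * monom_eval x m'"
proof -
  let ?S = "Poly_Mapping.keys m \<union> Poly_Mapping.keys m'"
  have "Poly_Mapping.keys (m + m') \<subseteq> ?S" by (rule keys_add)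
  then show ?thesis
    by (simp add: monom_eval_superset[of ?S] lookup_add power_add prod.distrib)
qed

lemma meval_superset:
  assumes "finite S" "Poly_Mapping.keys p \<subseteq> S"
  shows "meval x p = (\<Sum>m\<in>S. h (Poly_Mapping.lookup p m) * monom_eval x m)"
  unfolding meval_def
  by (rule sum.mono_neutral_left) (use assms in \<open>auto simp: in_keys_iff hom_zero\<close>)

lemma meval_add: "meval x (p + q) = meval x p + meval x q"
proof -
  let ?S = "Poly_Mapping.keys p \<union> Poly_Mapping.keys q"
  have "Poly_Mapping.keys (p + q) \<subseteq> ?S" by (rule keys_add)
  then show ?thesis
    by (simp add: meval_superset[of ?S] lookup_add hom_add distrib_right sum.distrib)
qed

lemma meval_zero: "meval x 0 = 0"
  by (simp add: meval_def)

lemma meval_single: "meval x (Poly_Mapping.single m c) = h c * monom_eval x m"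
  by (simp add: meval_def hom_zero)

lemma meval_sum: "meval x (sum f A) = (\<Sum>a\<in>A. meval x (f a))"
  by (induction A rule: infinite_finite_induct) (simp_all add: meval_zero meval_add)

end

lemma dvd_prod_diff:
  fixes d :: "'a::comm_ring_1"
  assumes "\<And>i. i \<in> A \<Longrightarrow> d dvd f i - g i"
  shows "d dvd prod f A - prod g A"
  using assms
proof (induction A rule: infinite_finite_induct)
  case (insert a A)
  have "f a * prod f A - g a * prod g A
      = f a * (prod f A - prod g A) + (f a - g a) * prod g A"
    by (simp add: algebra_simps)
  moreover have "d dvd f a * (prod f A - prod g A) + (f a - g a) * prod g A"
    using insert by (intro dvd_add dvd_mult dvd_mult2) auto
  ultimately show ?case using insert by simp
qed simp_all

lemma poly_mapping_sum_single:
  "p = (\<Sum>m\<in>Poly_Mapping.keys p. Poly_Mapping.single m (Poly_Mapping.lookup p m))"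
proof (rule poly_mapping_eqI)
  fix k
  show "Poly_Mapping.lookup p k = Poly_Mapping.lookup (\<Sum>m\<in>Poly_Mapping.keys p. Poly_Mapping.single m (Poly_Mapping.lookup p m)) k"
    by (cases "k \<in> Poly_Mapping.keys p") (auto simp: lookup_sum lookup_single when_def in_keys_iff)
qed

context coeff_hom
begin

lemma meval_mult: "meval x (p * q) = meval x p * meval x q"
proof -
  have "p * q = (\<Sum>m\<in>Poly_Mapping.keys p. \<Sum>m'\<in>Poly_Mapping.keys q.
      Poly_Mapping.single (m + m') (Poly_Mapping.lookup p m * Poly_Mapping.lookup q m'))"
    by (subst (1) poly_mapping_sum_single[of p], subst (1) poly_mapping_sum_single[of q])
       (simp add: sum_product mult_single)
  then have "meval x (p * q) = (\<Sum>m\<in>Poly_Mapping.keys p. \<Sum>m'\<in>Poly_Mapping.keys q.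
      h (Poly_Mapping.lookup p m * Poly_Mapping.lookup q m') * monom_eval x (m + m'))"
    by (simp add: meval_sum meval_single)
  then show ?thesis
    by (simp add: hom_mult monom_eval_add meval_def sum_product ac_simps)
qed

lemma meval_const: "meval x (mpoly_const c) = h c"
  by (simp add: mpoly_const_def meval_single monom_eval_def)

lemma meval_one: "meval x 1 = 1"
  using meval_const[of x 1] by (simp add: mpoly_const_def hom_one)

lemma meval_var: "meval x (mpoly_var i) = x i"
  by (simp add: mpoly_var_def meval_single monom_eval_def hom_one)

lemma meval_uminus: "meval x (- p) = - meval x p"
  using meval_add[of x p "- p"] by (simp add: meval_zero eq_neg_iff_add_eq_0 add.commute)

lemma meval_diff: "meval x (p - q) = meval x p - meval x q"
  using meval_add[of x p "- q"] by (simp add: meval_uminus)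

lemma meval_prod: "meval x (prod f A) = (\<Prod>a\<in>A. meval x (f a))"
  by (induction A rule: infinite_finite_induct) (simp_all add: meval_one meval_mult)

lemma meval_power: "meval x (p ^ n) = meval x p ^ n"
  by (induction n) (simp_all add: meval_one meval_mult)

lemma meval_of_int_sign: "meval x (of_int (sign \<sigma>)) = of_int (sign \<sigma>)"
  by (simp add: sign_def meval_one meval_uminus)

lemmas meval_simps = meval_add meval_mult meval_const meval_one meval_zero meval_var
  meval_uminus meval_diff meval_prod meval_power meval_sum meval_of_int_sign

text \<open>
Congruent points have congruent values. Taking \<open>d = x\<^sub>a - x\<^sub>b\<close>, this is what turns vanishing under
the identification of \<open>x\<^sub>a\<close> with \<open>x\<^sub>b\<close> into divisibility.
\<close>

lemma meval_cong_dvd: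
  assumes "\<And>i. d dvd x i - y i"
  shows "d dvd meval x p - meval y p"
proof -
  have power: "d dvd x i ^ n - y i ^ n" for i n
    using dvd_prod_diff[of "{..<n}" d "\<lambda>_. x i" "\<lambda>_. y i"] assms by simp
  have "meval x p - meval y p
      = (\<Sum>m\<in>Poly_Mapping.keys p. h (Poly_Mapping.lookup p m) * (monom_eval x m - monom_eval y m))"
    by (simp add: meval_def sum_subtractf right_diff_distrib)
  also have "d dvd \<dots>"
    unfolding monom_eval_def by (intro dvd_sum dvd_mult dvd_prod_diff power)
  finally show ?thesis .
qed

end

interpretation mpoly_const: coeff_hom "mpoly_const :: 'a::comm_ring_1 \<Rightarrow> 'a mpoly"
  by standard (simp_all add: mpoly_const_def single_add mult_single)

interpretation id: coeff_hom "\<lambda>c :: 'a::comm_ring_1. c"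
  by standard simp_all

lemma mpoly_eval_eq_meval: "mpoly_eval = id.meval"
  by (simp add: fun_eq_iff mpoly_eval_def id.meval_def id.monom_eval_def)

section \<open>Divisibility by differences of variables\<close>

abbreviation subst_mpoly :: "(nat \<Rightarrow> 'a mpoly) \<Rightarrow> 'a mpoly \<Rightarrow> 'a::comm_ring_1 mpoly" where
  "subst_mpoly \<equiv> mpoly_const.meval"

lemma monom_eval_var:
  "mpoly_const.monom_eval mpoly_var m = (Poly_Mapping.single m 1 :: 'a::comm_ring_1 mpoly)"
proof -
  have power: "mpoly_var i ^ k = (Poly_Mapping.single (Poly_Mapping.single i k) 1 :: 'a mpoly)" for i k
    by (induction k) (simp_all add: mpoly_var_def mult_single single_add[symmetric])
  have prod: "(\<Prod>i\<in>A. Poly_Mapping.single (f i) 1) = (Poly_Mapping.single (sum f A) 1 :: 'a mpoly)"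
    for A :: "nat set" and f
    by (induction A rule: infinite_finite_induct) (simp_all add: mult_single)
  show ?thesis
    unfolding mpoly_const.monom_eval_def power prod by (simp flip: poly_mapping_sum_single)
qed

lemma subst_mpoly_var: "subst_mpoly mpoly_var p = p"
  by (subst (2) poly_mapping_sum_single)
     (simp add: mpoly_const.meval_def monom_eval_var mpoly_const_def mult_single)

definition identify :: "nat \<Rightarrow> nat \<Rightarrow> 'a mpoly \<Rightarrow> 'a::comm_ring_1 mpoly" where
  "identify a b = subst_mpoly (mpoly_var(a := mpoly_var b))"

text \<open>
The factor theorem: identifying \<open>x\<^sub>a\<close> with \<open>x\<^sub>b\<close> does not change a polynomial modulo \<open>x\<^sub>a - x\<^sub>b\<close>,
and it is a homomorphism that kills \<open>x\<^sub>a - x\<^sub>b\<close>.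
\<close>

lemma var_diff_dvd_iff:
  "mpoly_var a - mpoly_var b dvd p \<longleftrightarrow> identify a b p = (0 :: 'a::comm_ring_1 mpoly)"
proof
  assume "mpoly_var a - mpoly_var b dvd p"
  then show "identify a b p = 0"
    by (auto simp: dvd_def identify_def mpoly_const.meval_simps)
next
  assume "identify a b p = 0"
  moreover have "mpoly_var a - mpoly_var b dvd subst_mpoly mpoly_var p - identify a b p"
    unfolding identify_def by (rule mpoly_const.meval_cong_dvd) simp
  ultimately show "mpoly_var a - mpoly_var b dvd p"
    by (simp add: subst_mpoly_var)
qed

lemma mpoly_var_eq_iff: "mpoly_var i = (mpoly_var j :: 'a::zero_neq_one mpoly) \<longleftrightarrow> i = j"
proof
  assume "mpoly_var i = (mpoly_var j :: 'a mpoly)"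
  then have "Poly_Mapping.keys (mpoly_var i :: 'a mpoly) = Poly_Mapping.keys (mpoly_var j :: 'a mpoly)" by simp
  then have "Poly_Mapping.single i (1::nat) = Poly_Mapping.single j 1"
    by (simp add: mpoly_var_def)
  then have "Poly_Mapping.keys (Poly_Mapping.single i (1::nat)) = Poly_Mapping.keys (Poly_Mapping.single j (1::nat))"
    by simp
  then show "i = j" by simp
qed simp

text \<open>
This replaces unique factorization. If \<open>p = D q\<close> where \<open>D\<close> is the product over the pairs treated
so far, then identifying the variables of a new pair kills \<open>p\<close> but none of the factors of \<open>D\<close>,
so it kills \<open>q\<close>, and the new factor divides \<open>q\<close>. Ordering each pair excludes that \<open>x\<^sub>a - x\<^sub>b\<close> and
\<open>x\<^sub>b - x\<^sub>a\<close> both occur.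
\<close>

lemma prod_var_diff_dvd:
  fixes p :: "'a::idom mpoly"
  assumes "finite S" and "\<And>i j. (j, i) \<in> S \<Longrightarrow> i < j"
    and "\<And>i j. (j, i) \<in> S \<Longrightarrow> mpoly_var i - mpoly_var j dvd p"
  shows "(\<Prod>(j, i)\<in>S. mpoly_var i - mpoly_var j) dvd p"
  using assms
proof (induction S rule: finite_induct)
  case (insert ba S)
  obtain a b where ba: "ba = (b, a)" by force
  have "a < b" using insert.prems ba by auto
  let ?d = "\<lambda>(j, i). mpoly_var i - mpoly_var j :: 'a mpoly"
  have "prod ?d S dvd p" using insert by auto
  then obtain q where q: "p = prod ?d S * q" by (auto simp: dvd_def)
  have "identify a b p = 0"
    using insert.prems(2)[of b a] ba var_diff_dvd_iff[of a b p] by simp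
  then have "identify a b (prod ?d S) * identify a b q = 0"
    by (simp add: q identify_def mpoly_const.meval_mult)
  moreover have "identify a b (prod ?d S) \<noteq> 0"
  proof -
    have "identify a b (?d e) \<noteq> 0" if "e \<in> S" for e
    proof -
      obtain i j where e: "e = (j, i)" by force
      have "i < j" using insert.prems that e by auto
      moreover have "(j, i) \<noteq> (b, a)" using insert.hyps that ba e by auto
      ultimately show ?thesis using \<open>a < b\<close>
        by (auto simp: e identify_def mpoly_const.meval_simps mpoly_var_eq_iff)
    qed
    then show ?thesis
      using insert.hyps(1) by (simp add: identify_def mpoly_const.meval_prod)
  qed
  ultimately have "identify a b q = 0" by simp
  then have "mpoly_var a - mpoly_var b dvd q" by (simp add: var_diff_dvd_iff)
  then have "(mpoly_var a - mpoly_var b) * prod ?d S dvd q * prod ?d S"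
    by (rule mult_dvd_mono) simp
  then show ?case using insert.hyps by (simp add: ba q mult.commute)
qed simp

section \<open>The Vandermonde product and antisymmetric sums\<close>

definition vandermonde :: "nat \<Rightarrow> (nat \<Rightarrow> 'a) \<Rightarrow> 'a::comm_ring_1" where
  "vandermonde n x = (\<Prod>j<n. \<Prod>i<j. x i - x j)"

lemma vandermonde_altdef:
  "vandermonde n x = (\<Prod>(j, i)\<in>(SIGMA j:{..<n}. {..<j}). x i - x j)"
  unfolding vandermonde_def by (rule prod.Sigma) auto

text \<open>
An adjacent transposition keeps every pair \<open>i < j\<close> in order except the pair \<open>(a, a + 1)\<close> itself,
so it permutes all other factors and negates that one.
\<close>

lemma vandermonde_swap_adjacent:
  assumes "Suc a < n"
  shows "vandermonde n (x \<circ> transpose a (Suc a)) = - vandermonde n x"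
proof -
  let ?P = "SIGMA j:{..<n}. {..<j}" and ?e = "(Suc a, a)" and ?\<tau> = "transpose a (Suc a)"
  have fin: "finite ?P" and mem: "?e \<in> ?P" using assms by auto
  have image: "map_prod ?\<tau> ?\<tau> e \<in> ?P - {?e}" if "e \<in> ?P - {?e}" for e
    using that assms by (cases e) (simp add: transpose_def, linarith)
  have inverse: "map_prod ?\<tau> ?\<tau> (map_prod ?\<tau> ?\<tau> e) = e" for e
    by (cases e) simp
  have "map_prod ?\<tau> ?\<tau> ` (?P - {?e}) \<subseteq> ?P - {?e}"
    using image by (rule image_subsetI)
  then have "bij_betw (map_prod ?\<tau> ?\<tau>) (?P - {?e}) (?P - {?e})"
    by (intro bij_betw_byWitness[where f' = "map_prod ?\<tau> ?\<tau>"] ballI inverse)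
  from prod.reindex_bij_betw[OF this, of "\<lambda>(j, i). x i - x j"]
  have others: "(\<Prod>(j, i)\<in>?P - {?e}. x (?\<tau> i) - x (?\<tau> j)) = (\<Prod>(j, i)\<in>?P - {?e}. x i - x j)"
    by (simp add: case_prod_beta)
  show ?thesis
    unfolding vandermonde_altdef prod.remove[OF fin mem] comp_def others
    by (simp only: split_conv mult_minus_left[symmetric] minus_diff_eq transpose_apply_first transpose_apply_second)
qed

text \<open>
Any transposition is a product of an odd number of adjacent ones, by
\<open>(a, b + 1) = (b, b + 1) (a, b) (b, b + 1)\<close>.
\<close>

lemma vandermonde_swap:
  assumes "a < b" "b < n"
  shows "vandermonde n (x \<circ> transpose a b) = - vandermonde n x"
  using assms
proof (induction b arbitrary: x)
  case (Suc b)
  show ?case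
  proof (cases "a = b")
    case True
    then show ?thesis using vandermonde_swap_adjacent Suc.prems by blast
  next
    case False
    let ?s = "transpose b (Suc b)"
    have "transpose a (Suc b) = ?s \<circ> transpose a b \<circ> ?s"
      using False Suc.prems transpose_comp_triple[of "Suc b" a b]
      by (simp add: transpose_commute)
    then have "vandermonde n (x \<circ> transpose a (Suc b))
        = vandermonde n (x \<circ> ?s \<circ> transpose a b \<circ> ?s)"
      by (simp add: comp_assoc)
    also have "\<dots> = - vandermonde n x"
      using Suc.prems False
      by (simp only: Suc.IH vandermonde_swap_adjacent minus_minus)
    finally show ?thesis .
  qed
qed simp

lemma vandermonde_permute:
  assumes "\<sigma> permutes {..<n}"
  shows "vandermonde n (x \<circ> \<sigma>) = of_int (sign \<sigma>) * vandermonde n x"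
  using assms finite_lessThan
proof (induction arbitrary: x rule: permutes_induct)
  case id
  then show ?case by simp
next
  case (swap a b p)
  have perm: "permutation p" using swap by (auto simp: permutation_permutes)
  have "vandermonde n (x \<circ> transpose a b) = - vandermonde n x"
    using swap vandermonde_swap[of a b n x] vandermonde_swap[of b a n x]
    by (cases "a < b") (simp_all add: transpose_commute)
  moreover have "sign (transpose a b \<circ> p) = - sign p"
    using swap perm by (simp add: sign_compose permutation_swap_id sign_swap_id)
  ultimately show ?case
    using swap.IH[of "x \<circ> transpose a b"] by (simp only: comp_assoc) simp
qed

text \<open>
Composition with the transposition matches the even permutations with the odd ones and preserves
the summand. Cancelling them in pairs, instead of showing that the sum is its own negative, makes
the argument valid in every characteristic.
\<close>

lemma sum_sign_eq_0:
  fixes f :: "('b \<Rightarrow> 'b) \<Rightarrow> 'a::comm_ring_1"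
  assumes "finite S" "a \<in> S" "b \<in> S" "a \<noteq> b"
    and sym: "\<And>\<sigma>. \<sigma> permutes S \<Longrightarrow> f (transpose a b \<circ> \<sigma>) = f \<sigma>"
  shows "(\<Sum>\<sigma> | \<sigma> permutes S. of_int (sign \<sigma>) * f \<sigma>) = 0"
proof -
  let ?E = "{\<sigma>. \<sigma> permutes S \<and> evenperm \<sigma>}" and ?O = "{\<sigma>. \<sigma> permutes S \<and> \<not> evenperm \<sigma>}"
  let ?\<tau> = "transpose a b"
  have fin: "finite {\<sigma>. \<sigma> permutes S}" using assms by (simp add: finite_permutations)
  have \<tau>: "?\<tau> permutes S" using assms by (simp add: permutes_swap_id)
  have swap: "?\<tau> \<circ> \<sigma> permutes S" "evenperm (?\<tau> \<circ> \<sigma>) \<longleftrightarrow> \<not> evenperm \<sigma>" "?\<tau> \<circ> (?\<tau> \<circ> \<sigma>) = \<sigma>"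
    if "\<sigma> permutes S" for \<sigma>
  proof -
    have "permutation \<sigma>" using that assms by (auto simp: permutation_permutes)
    then show "evenperm (?\<tau> \<circ> \<sigma>) \<longleftrightarrow> \<not> evenperm \<sigma>"
      using assms by (simp add: evenperm_comp permutation_swap_id evenperm_swap)
  qed (use that \<tau> in \<open>auto simp: permutes_compose simp flip: comp_assoc\<close>)
  have odd_even: "sum f ?O = sum f ?E"
    by (rule sum.reindex_bij_witness[where i = "\<lambda>\<sigma>. ?\<tau> \<circ> \<sigma>" and j = "\<lambda>\<sigma>. ?\<tau> \<circ> \<sigma>"])
       (auto simp: swap sym)
  have split: "{\<sigma>. \<sigma> permutes S} = ?E \<union> ?O" by blast
  have fin': "finite ?E" "finite ?O" using fin by simp_all
  have "(\<Sum>\<sigma> | \<sigma> permutes S. of_int (sign \<sigma>) * f \<sigma>)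
      = (\<Sum>\<sigma>\<in>?E. of_int (sign \<sigma>) * f \<sigma>) + (\<Sum>\<sigma>\<in>?O. of_int (sign \<sigma>) * f \<sigma>)"
    unfolding split by (rule sum.union_disjoint[OF fin']) blast
  also have "\<dots> = sum f ?E - sum f ?O" by (simp add: sign_def sum_negf)
  finally show ?thesis by (simp add: odd_even)
qed

text \<open>
The hypothesis says that \<open>m + 1\<close> never stands to the left of \<open>m\<close> in the word
\<open>\<sigma> 0, \<sigma> 1, \<dots>\<close>. So \<open>\<sigma>\<^sup>-\<^sup>1\<close> is increasing, and an increasing permutation is the identity.
\<close>

lemma permutes_eq_id_if_no_descent:
  assumes \<sigma>: "\<sigma> permutes {..<n}"
    and no_desc: "\<And>i j. i < j \<Longrightarrow> j < n \<Longrightarrow> \<sigma> i \<noteq> Suc (\<sigma> j)"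
  shows "\<sigma> = id"
proof -
  let ?\<pi> = "inv \<sigma>"
  have \<pi>: "?\<pi> permutes {..<n}" using \<sigma> by (rule permutes_inv)
  have \<pi>_less: "?\<pi> m < n" if "m < n" for m
    using permutes_in_image[OF \<pi>, of m] that by simp
  have step: "?\<pi> m < ?\<pi> (Suc m)" if "Suc m < n" for m
  proof (rule ccontr)
    assume "\<not> ?\<pi> m < ?\<pi> (Suc m)"
    moreover have "?\<pi> m \<noteq> ?\<pi> (Suc m)"
      using permutes_inj[OF \<pi>] by (metis injD n_not_Suc_n)
    ultimately have "?\<pi> (Suc m) < ?\<pi> m" by simp
    then show False
      using no_desc[of "?\<pi> (Suc m)" "?\<pi> m"] \<pi>_less[of m] that
      by (simp add: permutes_inverses[OF \<sigma>])
  qed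
  have "m \<le> ?\<pi> m" if "m < n" for m
    using that
  proof (induction m)
    case (Suc m)
    then show ?case using step[of m] by simp
  qed simp
  then have "?\<pi> = id"
    using permutes_natset_ge[OF \<pi>] by simp
  then show ?thesis by (metis \<sigma> inv_id permutes_inv_inv)
qed

section \<open>The symmetrization is a polynomial\<close>

lemma to_fract_sum: "to_fract (sum f A) = (\<Sum>a\<in>A. to_fract (f a))"
  by (induction A rule: infinite_finite_induct) simp_all

lemma to_fract_prod: "to_fract (prod f A) = (\<Prod>a\<in>A. to_fract (f a))"
  by (induction A rule: infinite_finite_induct) simp_all

lemma to_fract_power: "to_fract (x ^ n) = to_fract x ^ n"
  by (induction n) simp_all

lemmas to_fract_simps = to_fract_add to_fract_mult to_fract_diff to_fract_sum to_fract_prod to_fract_power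

text \<open>
The summand of the symmetrization at the identity, cleared of its Vandermonde denominator.
\<close>

definition hl_numerator ::
    "nat \<Rightarrow> (nat \<Rightarrow> nat) \<Rightarrow> 'a \<Rightarrow> (nat \<Rightarrow> 'a) \<Rightarrow> 'a::comm_ring_1" where
  "hl_numerator n \<mu> t x = (\<Prod>i<n. x i ^ \<mu> i) * (\<Prod>j<n. \<Prod>i<j. x i - t * x j)"

lemma vandermonde_nonzero:
  fixes x :: "nat \<Rightarrow> 'a::idom"
  assumes "inj x"
  shows "vandermonde n x \<noteq> 0"
  using assms by (auto simp: vandermonde_def dest: injD)

text \<open>
After \<open>x\<^sub>a\<close> and \<open>x\<^sub>b\<close> are identified, the summands of \<open>\<sigma>\<close> and \<open>(a, b) \<sigma>\<close> agree up to their opposite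
signs, so the sum vanishes.
\<close>

lemma vandermonde_dvd_antisymmetrization:
  fixes t :: "'a::idom"
  shows "vandermonde n mpoly_var dvd
    (\<Sum>\<sigma> | \<sigma> permutes {..<n}.
       of_int (sign \<sigma>) * hl_numerator n \<mu> (mpoly_const t) (mpoly_var \<circ> \<sigma>))"
    (is "_ dvd ?N")
proof -
  have "mpoly_var a - mpoly_var b dvd ?N" if "a < b" "b < n" for a b
  proof -
    \<comment> \<open>The variables after the identification; they no longer see the transposition of \<open>a\<close> and \<open>b\<close>.\<close>
    let ?x = "(mpoly_var(a := mpoly_var b)) :: nat \<Rightarrow> 'a mpoly"
    have "identify a b ?N
        = (\<Sum>\<sigma> | \<sigma> permutes {..<n}. of_int (sign \<sigma>) * hl_numerator n \<mu> (mpoly_const t) (?x \<circ> \<sigma>))"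
      unfolding identify_def hl_numerator_def comp_def mpoly_const.meval_simps ..
    also have "\<dots> = 0"
    proof (rule sum_sign_eq_0)
      have "?x \<circ> transpose a b = ?x" by (auto simp: fun_eq_iff transpose_def)
      then have "?x \<circ> (transpose a b \<circ> \<sigma>) = ?x \<circ> \<sigma>" for \<sigma> :: "nat \<Rightarrow> nat"
        by (simp only: comp_assoc[symmetric])
      then show "hl_numerator n \<mu> (mpoly_const t) (?x \<circ> (transpose a b \<circ> \<sigma>))
          = hl_numerator n \<mu> (mpoly_const t) (?x \<circ> \<sigma>)" for \<sigma>
        by (simp only:)
    qed (use that in auto)
    finally show ?thesis by (simp add: var_diff_dvd_iff)
  qed
  then show ?thesis
    unfolding vandermonde_altdef by (intro prod_var_diff_dvd) auto
qed

text \<open>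
The denominator of the \<open>\<sigma>\<close>-summand is the permuted Vandermonde product, hence the fixed one up to
the sign of \<open>\<sigma>\<close>.
\<close>

lemma hl_symmetrization_antisymmetrization:
  fixes x :: "nat \<Rightarrow> 'a::field"
  shows "hl_symmetrization n \<mu> t x
    = (\<Sum>\<sigma> | \<sigma> permutes {..<n}. of_int (sign \<sigma>) * hl_numerator n \<mu> t (x \<circ> \<sigma>))
      / (vandermonde n x * hl_v_partition n \<mu> t)"
proof -
  have "(\<Prod>i<n. x (\<sigma> i) ^ \<mu> i) * (\<Prod>j<n. \<Prod>i<j. (x (\<sigma> i) - t * x (\<sigma> j)) / (x (\<sigma> i) - x (\<sigma> j)))
      = of_int (sign \<sigma>) * hl_numerator n \<mu> t (x \<circ> \<sigma>) / vandermonde n x"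
    if "\<sigma> permutes {..<n}" for \<sigma>
  proof -
    have "(\<Prod>i<n. x (\<sigma> i) ^ \<mu> i) * (\<Prod>j<n. \<Prod>i<j. (x (\<sigma> i) - t * x (\<sigma> j)) / (x (\<sigma> i) - x (\<sigma> j)))
        = hl_numerator n \<mu> t (x \<circ> \<sigma>) / vandermonde n (x \<circ> \<sigma>)"
      by (simp add: hl_numerator_def vandermonde_def prod_dividef)
    also have "vandermonde n (x \<circ> \<sigma>) = of_int (sign \<sigma>) * vandermonde n x"
      using that by (rule vandermonde_permute)
    finally show ?thesis by (simp add: sign_def comp_def)
  qed
  then show ?thesis
    by (simp add: hl_symmetrization_def flip: sum_divide_distrib)
qed

text \<open>
The normalization \<open>v\<^sub>\<mu>\<close> that is used in the field of rational functions is a constant of the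
coefficient field, so dividing by it does not leave the polynomials.
\<close>

lemma hl_v_partition_fract:
  fixes t :: "'a::field"
  shows "hl_v_partition n \<mu> (to_fract (mpoly_const t)) = to_fract (mpoly_const (hl_v_partition n \<mu> t))"
proof -
  let ?c = "\<lambda>a :: 'a. to_fract (mpoly_const a)"
  interpret c: coeff_hom ?c
    by standard (simp_all add: mpoly_const.hom_add mpoly_const.hom_mult mpoly_const.hom_one)
  have prod: "?c (prod f A) = (\<Prod>a\<in>A. ?c (f a))" for f and A :: "nat set"
    by (induction A rule: infinite_finite_induct) (simp_all add: c.hom_mult c.hom_one)
  have power: "?c (a ^ k) = ?c a ^ k" for a k
    using prod[of "\<lambda>_. a" "{..<k}"] by simp
  have diff: "?c (a - b) = ?c a - ?c b" for a b
    using c.hom_add[of "a - b" b] by simp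
  have divide: "?c (a / b) = ?c a / ?c b" for a b
  proof (cases "b = 0")
    case False
    then have "?c (a / b) * ?c b = ?c a" "?c b * ?c (1 / b) = 1"
      by (simp_all add: c.hom_one flip: c.hom_mult)
    then show ?thesis by (metis nonzero_eq_divide_eq mult_zero_left zero_neq_one)
  qed (simp add: c.hom_zero)
  show ?thesis
    by (simp only: hl_v_partition_def hl_v_def prod power diff divide c.hom_one)
qed

text \<open>
The definition of \<open>P\<^sub>\<mu>\<close> by a quotient of rational functions becomes an identity of polynomials,
to which evaluation homomorphisms apply.
\<close>

lemma hall_littlewood_times_vandermonde:
  fixes t :: "'a::field"
  assumes "\<mu> n = 0" and v: "hl_v_partition n \<mu> t \<noteq> 0"
  shows "vandermonde n mpoly_var * mpoly_const (hl_v_partition n \<mu> t) * hall_littlewood n \<mu> t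
    = (\<Sum>\<sigma> | \<sigma> permutes {..<n}.
         of_int (sign \<sigma>) * hl_numerator n \<mu> (mpoly_const t) (mpoly_var \<circ> \<sigma>))"
    (is "?D * ?v * _ = ?N")
proof -
  have fract_sign: "to_fract (of_int (sign \<sigma>)) = of_int (sign \<sigma>)" for \<sigma> :: "nat \<Rightarrow> nat"
    by (simp add: sign_def)
  have sym: "hl_symmetrization n \<mu> (to_fract (mpoly_const t)) (\<lambda>i. to_fract (mpoly_var i))
      = to_fract ?N / to_fract (?D * ?v)"
    unfolding hl_symmetrization_antisymmetrization hl_v_partition_fract
    by (simp add: hl_numerator_def vandermonde_def to_fract_simps fract_sign)
  have "mpoly_const (1 / hl_v_partition n \<mu> t) * ?v = (1 :: 'a mpoly)"
    using v by (simp add: mpoly_const.hom_one flip: mpoly_const.hom_mult)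
  then have inv: "?v * mpoly_const (1 / hl_v_partition n \<mu> t) = (1 :: 'a mpoly)"
    by (simp add: mult.commute)
  then have nz: "?D * ?v \<noteq> 0"
    using vandermonde_nonzero[of "mpoly_var :: nat \<Rightarrow> 'a mpoly" n]
    by (auto simp: inj_def mpoly_var_eq_iff)
  obtain q where "?N = ?D * q"
    using vandermonde_dvd_antisymmetrization by (rule dvdE)
  also have "\<dots> = ?D * ?v * (mpoly_const (1 / hl_v_partition n \<mu> t) * q)"
    by (simp only: mult.assoc mult.assoc[symmetric, of ?v] inv mult_1_left)
  finally obtain p where p: "?N = ?D * ?v * p" by blast
  have "hall_littlewood n \<mu> t = p"
  proof -
    have p_fract: "to_fract p = to_fract ?N / to_fract (?D * ?v)"
      using nz unfolding p to_fract_mult by simp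
    show ?thesis
      unfolding hall_littlewood_def sym p_fract[symmetric] using \<open>\<mu> n = 0\<close> by simp
  qed
  then show ?thesis using p by simp
qed

section \<open>The principal specialization\<close>

lemma qfactorial_telescope:
  fixes t :: "'a::field"
  assumes "\<And>m. m > 0 \<Longrightarrow> t ^ m \<noteq> 1"
  shows "(\<Prod>d<j. (1 - t ^ Suc (Suc d)) / (1 - t ^ Suc d)) = (1 - t ^ Suc j) / (1 - t)"
proof (induction j)
  case 0
  then show ?case using assms[of 1] by simp
next
  case (Suc j)
  have "1 - t ^ Suc j \<noteq> 0" using assms[of "Suc j"] by simp
  then show ?case by (simp only: prod.lessThan_Suc Suc.IH) (simp del: power_Suc)
qed

lemma hl_v_lessThan: "hl_v t n = (\<Prod>j<n. (1 - t ^ Suc j) / (1 - t))"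
  by (induction n) (simp_all add: hl_v_def)

lemma hl_v_nonzero:
  assumes "\<And>m. m > 0 \<Longrightarrow> t ^ m \<noteq> 1"
  shows "hl_v t n \<noteq> 0"
  using assms assms[of 1] by (auto simp: hl_v_def)

text \<open>
For fixed \<open>j\<close> the factor depends on \<open>d = j - i\<close> only: it is \<open>(1 - t\<^sup>d\<^sup>+\<^sup>1) / (1 - t\<^sup>d)\<close>, and the
product over \<open>d = 1, \<dots>, j\<close> telescopes.
\<close>

lemma prod_principal_column:
  fixes t :: "'a::field"
  assumes "t \<noteq> 0" and no_root: "\<And>m. m > 0 \<Longrightarrow> t ^ m \<noteq> 1"
  shows "(\<Prod>i<j. (t ^ i - t * t ^ j) / (t ^ i - t ^ j)) = (1 - t ^ Suc j) / (1 - t)"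
proof -
  have factor: "(t ^ i - t * t ^ j) / (t ^ i - t ^ j)
      = (1 - t ^ Suc (Suc (j - Suc i))) / (1 - t ^ Suc (j - Suc i))" if "i < j" for i
  proof -
    have "t ^ j = t ^ i * t ^ Suc (j - Suc i)" using that by (simp flip: power_add power_Suc)
    then have "(t ^ i - t * t ^ j) / (t ^ i - t ^ j)
        = (t ^ i * (1 - t ^ Suc (Suc (j - Suc i)))) / (t ^ i * (1 - t ^ Suc (j - Suc i)))"
      by (simp add: algebra_simps)
    then show ?thesis using \<open>t \<noteq> 0\<close> by simp
  qed
  have "(\<Prod>i<j. (t ^ i - t * t ^ j) / (t ^ i - t ^ j))
      = (\<Prod>i<j. (1 - t ^ Suc (Suc (j - Suc i))) / (1 - t ^ Suc (j - Suc i)))"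
    by (rule prod.cong) (use factor in auto)
  also have "\<dots> = (\<Prod>d<j. (1 - t ^ Suc (Suc d)) / (1 - t ^ Suc d))"
    by (rule prod.nat_diff_reindex)
  finally show ?thesis using qfactorial_telescope[OF no_root] by simp
qed

text \<open>
Only the identity contributes to the antisymmetrization at \<open>x\<^sub>i = t\<^sup>i\<close>. That \<open>t\<close> is neither 0 nor a
root of unity ensures that these points are distinct and that \<open>v\<^sub>\<mu>(t)\<close> does not vanish.
\<close>

theorem hall_littlewood_principal_specialization:
  fixes t :: "'a::field"
  assumes "\<mu> n = 0" and "t \<noteq> 0" and no_root: "\<And>m. m > 0 \<Longrightarrow> t ^ m \<noteq> 1"
  shows "mpoly_eval (\<lambda>i. t ^ i) (hall_littlewood n \<mu> t)
    = t ^ (\<Sum>i<n. i * \<mu> i) * hl_v t n / hl_v_partition n \<mu> t"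
proof -
  let ?x = "\<lambda>i. t ^ i"
  let ?v = "hl_v_partition n \<mu> t"
  have v: "?v \<noteq> 0"
    by (simp add: hl_v_partition_def hl_v_nonzero no_root)
  have inj: "inj ?x"
  proof (rule linorder_injI)
    fix i j :: nat
    assume "i < j"
    then have "t ^ j = t ^ i * t ^ (j - i)" by (simp flip: power_add)
    then show "t ^ i \<noteq> t ^ j"
      using no_root[of "j - i"] \<open>i < j\<close> \<open>t \<noteq> 0\<close> by simp
  qed
  have D: "vandermonde n ?x \<noteq> 0" by (rule vandermonde_nonzero[OF inj])
  have vanish: "hl_numerator n \<mu> t (?x \<circ> \<sigma>) = 0" if "\<sigma> permutes {..<n}" "\<sigma> \<noteq> id" for \<sigma>
  proof -
    have "\<exists>i j. i < j \<and> j < n \<and> \<sigma> i = Suc (\<sigma> j)"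
    proof (rule ccontr)
      assume "\<not> ?thesis"
      then have "\<sigma> = id" by (intro permutes_eq_id_if_no_descent[OF that(1)]) auto
      with that(2) show False ..
    qed
    then obtain i j where "i < j" "j < n" "\<sigma> i = Suc (\<sigma> j)" by auto
    then have "(\<Prod>i<j. (?x \<circ> \<sigma>) i - t * (?x \<circ> \<sigma>) j) = 0"
      by (intro prod_zero) (auto intro!: bexI[of _ i])
    then have "\<exists>j\<in>{..<n}. (\<Prod>i<j. (?x \<circ> \<sigma>) i - t * (?x \<circ> \<sigma>) j) = 0"
      using \<open>j < n\<close> by blast
    then have "(\<Prod>j<n. \<Prod>i<j. (?x \<circ> \<sigma>) i - t * (?x \<circ> \<sigma>) j) = 0"
      by (rule prod_zero[OF finite_lessThan])
    then show ?thesis unfolding hl_numerator_def by simp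
  qed
  have "vandermonde n ?x * ?v * mpoly_eval ?x (hall_littlewood n \<mu> t)
      = mpoly_eval ?x (vandermonde n mpoly_var * mpoly_const ?v * hall_littlewood n \<mu> t)"
    unfolding mpoly_eval_eq_meval vandermonde_def id.meval_simps ..
  also have "\<dots> = (\<Sum>\<sigma> | \<sigma> permutes {..<n}. of_int (sign \<sigma>) * hl_numerator n \<mu> t (?x \<circ> \<sigma>))"
    unfolding hall_littlewood_times_vandermonde[OF \<open>\<mu> n = 0\<close> v] mpoly_eval_eq_meval
      hl_numerator_def comp_def id.meval_simps ..
  also have "\<dots> = (\<Sum>\<sigma>\<in>{id}. of_int (sign \<sigma>) * hl_numerator n \<mu> t (?x \<circ> \<sigma>))"
    by (rule sum.mono_neutral_right)
       (auto simp: finite_permutations permutes_id vanish)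
  also have "\<dots> = hl_numerator n \<mu> t ?x" by simp
  finally have "mpoly_eval ?x (hall_littlewood n \<mu> t) = hl_numerator n \<mu> t ?x / vandermonde n ?x / ?v"
    using D v by (simp add: field_simps)
  also have "hl_numerator n \<mu> t ?x / vandermonde n ?x
      = (\<Prod>i<n. t ^ (i * \<mu> i)) * (\<Prod>j<n. \<Prod>i<j. (t ^ i - t * t ^ j) / (t ^ i - t ^ j))"
    by (simp add: hl_numerator_def vandermonde_def prod_dividef power_mult)
  also have "(\<Prod>i<n. t ^ (i * \<mu> i)) = t ^ (\<Sum>i<n. i * \<mu> i)" by (simp add: power_sum)
  also have "(\<Prod>j<n. \<Prod>i<j. (t ^ i - t * t ^ j) / (t ^ i - t ^ j)) = hl_v t n"
    by (simp only: prod_principal_column[OF \<open>t \<noteq> 0\<close> no_root] hl_v_lessThan)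
  finally show ?thesis .
qed

section \<open>Conjugates of generalized staircases\<close>

text \<open>
The parts \<open>\<mu>\<^sub>1, \<dots>, \<mu>\<^sub>n\<close> form \<open>K\<close> blocks of length \<open>w\<close> and a last block of length \<open>n - wK\<close>, constant
with value \<open>c l\<close> on block \<open>l\<close>. The last block may be empty, which is harmless since \<open>v\<^sub>0 = 1\<close>.
\<close>

lemma hl_v_partition_blocks:
  fixes t :: "'a::field"
  assumes "w > 0" "w * K \<le> n" "inj_on c {..K}"
    and \<mu>: "\<And>i. i < n \<Longrightarrow> \<mu> i = c (min (i div w) K)"
  shows "hl_v_partition n \<mu> t = hl_v t w ^ K * hl_v t (n - w * K)"
proof -
  let ?F = "\<lambda>a. {i. i < n \<and> \<mu> i = a}"
  have fiber: "?F (c l) = {i. i < n \<and> min (i div w) K = l}" if "l \<le> K" for l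
    using \<mu> inj_onD[OF \<open>inj_on c {..K}\<close>] that by fastforce
  have full: "card (?F (c l)) = w" if "l < K" for l
  proof -
    have "w * Suc l \<le> w * K" using that by (intro mult_le_mono2) simp
    then have "Suc l * w \<le> n" using \<open>w * K \<le> n\<close> by (simp add: mult.commute)
    have div_iff: "i div w = l \<longleftrightarrow> l * w \<le> i \<and> i < Suc l * w" for i
      using less_eq_div_iff_mult_less_eq[OF \<open>w > 0\<close>, of l i]
        div_less_iff_less_mult[OF \<open>w > 0\<close>, of i "Suc l"] by linarith
    have min_iff: "min (i div w) K = l \<longleftrightarrow> i div w = l" for i
      using that by (auto simp: min_def)
    have "{i. i < n \<and> min (i div w) K = l} = {l * w..<Suc l * w}"
      using \<open>Suc l * w \<le> n\<close>
      by (intro set_eqI) (simp only: mem_Collect_eq atLeastLessThan_iff min_iff div_iff, linarith)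
    then show ?thesis using fiber[of l] that by simp
  qed
  have last: "card (?F (c K)) = n - w * K"
  proof -
    have min_iff: "min (i div w) K = K \<longleftrightarrow> K * w \<le> i" for i
      using less_eq_div_iff_mult_less_eq[OF \<open>w > 0\<close>, of K i]
      by (simp only: min.absorb_iff2[symmetric])
    have "{i. i < n \<and> min (i div w) K = K} = {K * w..<n}"
      by (intro set_eqI) (simp only: mem_Collect_eq atLeastLessThan_iff min_iff conj_commute)
    then show ?thesis using fiber[of K] by (simp add: mult.commute)
  qed
  have "hl_v_partition n \<mu> t = (\<Prod>a\<in>c ` {..K}. hl_v t (card (?F a)))"
    unfolding hl_v_partition_def
  proof (rule prod.mono_neutral_left)
    show "\<mu> ` {..<n} \<subseteq> c ` {..K}" using \<mu> by auto
    show "\<forall>a\<in>c ` {..K} - \<mu> ` {..<n}. hl_v t (card (?F a)) = 1"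
    proof
      fix a assume "a \<in> c ` {..K} - \<mu> ` {..<n}"
      then have "?F a = {}" by blast
      then show "hl_v t (card (?F a)) = 1" by (simp only: card.empty) (simp add: hl_v_def)
    qed
  qed simp
  also have "\<dots> = (\<Prod>l\<le>K. hl_v t (card (?F (c l))))"
    using \<open>inj_on c {..K}\<close> by (simp add: prod.reindex)
  also have "\<dots> = (\<Prod>l<K. hl_v t (card (?F (c l)))) * hl_v t (card (?F (c K)))"
    by (simp flip: lessThan_Suc_atMost)
  also have "\<dots> = hl_v t w ^ K * hl_v t (n - w * K)"
    using full last by simp
  finally show ?thesis .
qed

lemma conjugate_partition_of_list:
  "conjugate (partition_of_list xs) j = length (filter ((<) j) xs)"
proof -
  have "{i. j < nth_default 0 xs i} = {i. i < length xs \<and> j < xs ! i}"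
    by (auto simp: nth_default_def split: if_splits)
  then show ?thesis
    by (simp add: conjugate_def partition_of_list_def length_filter_conv_card)
qed

lemma length_filter_staircase_parts:
  assumes "w > 0"
  shows "length (filter ((<) j) (staircase_parts w s k)) = s * (k - 1 - j div w)"
proof (induction k)
  case (Suc k)
  show ?case
  proof (cases "k = 0")
    case False
    have "length (filter ((<) j) (staircase_parts w s (Suc k)))
        = (if j < w * k then s else 0) + s * (k - 1 - j div w)"
      using False Suc.IH by (simp add: staircase_parts_def)
    also have "j < w * k \<longleftrightarrow> j div w < k"
      using assms by (simp add: div_less_iff_less_mult mult.commute)
    also have "(if j div w < k then s else 0) + s * (k - 1 - j div w) = s * (k - j div w)"
    proof (cases "j div w < k")
      case True
      then have "k - j div w = Suc (k - 1 - j div w)" by simp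
      then show ?thesis using True by simp
    qed simp
    finally show ?thesis by simp
  qed (simp add: staircase_parts_def)
qed (simp add: staircase_parts_def)

lemma conjugate_staircase_mid:
  assumes "w > 0"
  shows "conjugate (staircase_mid w s k g) j = (if j < w * k then g else 0) + s * (k - 1 - j div w)"
  using length_filter_staircase_parts[OF assms]
  by (simp add: staircase_mid_def conjugate_partition_of_list)

text \<open>
For \<open>g = 0\<close> the \<open>k\<close>-th block of the conjugate has value 0, so the zeros number \<open>n - wk + w\<close> and only
\<open>k - 1\<close> blocks precede them.
\<close>

lemma hl_v_partition_conjugate_staircase_mid:
  fixes t :: "'a::field"
  assumes "w > 0" "s > 0" "k > 0" "w * k \<le> n"
  shows "hl_v_partition n (conjugate (staircase_mid w s k g)) t
    = (if g = 0 then hl_v t w ^ (k - 1) * hl_v t (n - w * k + w) else hl_v t w ^ k * hl_v t (n - w * k))"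
proof (cases "g = 0")
  case True
  have "w * (k - 1) + w = w * k" using \<open>k > 0\<close> by (cases k) simp_all
  then have rest: "w * (k - 1) \<le> n" "n - w * (k - 1) = n - w * k + w"
    using \<open>w * k \<le> n\<close> by linarith+
  have "hl_v_partition n (conjugate (staircase_mid w s k g)) t
      = hl_v t w ^ (k - 1) * hl_v t (n - w * (k - 1))"
  proof (rule hl_v_partition_blocks[where c = "\<lambda>l. s * (k - 1 - l)"])
    show "inj_on (\<lambda>l. s * (k - 1 - l)) {..k - 1}"
      using \<open>s > 0\<close> by (intro inj_onI) simp
    show "conjugate (staircase_mid w s k g) i = s * (k - 1 - min (i div w) (k - 1))" for i
      using True by (simp add: conjugate_staircase_mid[OF \<open>w > 0\<close>] min_def)
  qed (use assms rest in simp_all)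
  then show ?thesis using True rest by simp
next
  case False
  let ?c = "\<lambda>l. if l < k then g + s * (k - 1 - l) else 0"
  have "hl_v_partition n (conjugate (staircase_mid w s k g)) t = hl_v t w ^ k * hl_v t (n - w * k)"
  proof (rule hl_v_partition_blocks[where c = ?c])
    show "inj_on ?c {..k}"
      using False \<open>s > 0\<close> by (intro inj_onI) (auto split: if_splits)
    show "conjugate (staircase_mid w s k g) i = ?c (min (i div w) k)" for i
    proof -
      have "i < w * k \<longleftrightarrow> i div w < k"
        using \<open>w > 0\<close> by (simp add: div_less_iff_less_mult mult.commute)
      then show ?thesis by (simp add: conjugate_staircase_mid[OF \<open>w > 0\<close>] min_def)
    qed
  qed (use assms in simp_all)
  then show ?thesis using False by simp
qed

text \<open>
Each of the \<open>g\<close> rows \<open>wk\<close> contributes 1 to the first \<open>wk\<close> conjugate parts, hence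
\<open>0 + 1 + \<dots> + (wk - 1)\<close> to the weighted sum.
\<close>

lemma sum_conjugate_staircase_mid:
  assumes "w > 0" "w * k \<le> n"
  shows "(\<Sum>i<n. i * conjugate (staircase_mid w s k g) i)
    = g * ((w * k * (w * k - 1)) div 2) + (\<Sum>i<n. i * conjugate (staircase w s k) i)"
proof -
  have staircase: "staircase w s k = staircase_mid w s k 0"
    by (simp add: staircase_def staircase_mid_def)
  have "(\<Sum>i<n. i * (if i < w * k then g else 0)) = (\<Sum>i<w * k. g * i)"
    by (rule sum.mono_neutral_cong_right) (use assms in auto)
  also have "\<dots> = g * ((w * k * (w * k - 1)) div 2)"
    by (simp add: Sum_Ico_nat lessThan_atLeast0 flip: sum_distrib_left)
  finally show ?thesis
    by (simp add: staircase conjugate_staircase_mid[OF \<open>w > 0\<close>] distrib_left sum.distrib)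
qed

section \<open>The ratio of specializations\<close>

lemma gaussian_eq_hl_v:
  fixes t :: "'a::field"
  assumes "\<And>m. m > 0 \<Longrightarrow> t ^ m \<noteq> 1" "b \<le> a"
  shows "gaussian t a b = hl_v t a / (hl_v t b * hl_v t (a - b))"
proof -
  have "1 - t \<noteq> 0" using assms(1)[of 1] by simp
  then have "qpoch t t m = (1 - t) ^ m * hl_v t m" for m
    by (simp add: qpoch_def hl_v_lessThan prod_dividef)
  moreover have "(1 - t) ^ a = (1 - t) ^ b * (1 - t) ^ (a - b)"
    using \<open>b \<le> a\<close> by (simp flip: power_add)
  ultimately show ?thesis
    using \<open>1 - t \<noteq> 0\<close> by (simp add: gaussian_def)
qed

lemma indet_t_nonzero: "indet_t \<noteq> 0"
  by (simp add: indet_t_def)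

lemma indet_t_power_neq_1:
  assumes "m > 0"
  shows "indet_t ^ m \<noteq> 1"
proof
  assume "indet_t ^ m = 1"
  then have "to_fract ([:0, 1:] ^ m :: rat poly) = to_fract 1"
    by (simp add: indet_t_def to_fract_power)
  then have "([:0, 1:] ^ m :: rat poly) = 1" by (simp only: to_fract_eq_iff)
  then have "poly ([:0, 1:] ^ m) (0 :: rat) = 1" by simp
  then show False using assms by (simp add: poly_power zero_power)
qed

theorem P_spec_eq:
  assumes "\<mu> n = 0"
  shows "P_spec n \<mu> = indet_t ^ (\<Sum>i<n. i * \<mu> i) * hl_v indet_t n / hl_v_partition n \<mu> indet_t"
  unfolding P_spec_def
  by (intro hall_littlewood_principal_specialization assms indet_t_nonzero indet_t_power_neq_1)

theorem corollary7p5: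
  fixes k w s n :: nat
  assumes "k > 0" and "w > 0" and "s > 0" and "n > 0" and "n \<ge> w * k"
  shows "(\<forall>g\<in>{0..<s}.
            P_spec n (conjugate (staircase_mid w s k (g + 1)))
              / P_spec n (conjugate (staircase_mid w s k g))
            = indet_t ^ ((w * k * (w * k - 1)) div 2)
              * (if g = 0 then gaussian indet_t (n - w * k + w) w else 1))
       \<and> (\<forall>g\<in>{1..s}.
            P_spec n (conjugate (staircase_mid w s k g))
              / P_spec n (conjugate (staircase w s k))
            = indet_t ^ ((g * (w * k) * (w * k - 1)) div 2)
              * gaussian indet_t (n - w * k + w) w)"
proof -
  let ?t = indet_t and ?C = "(w * k * (w * k - 1)) div 2"
  let ?P = "\<lambda>g. P_spec n (conjugate (staircase_mid w s k g))"
  define G where "G = gaussian ?t (n - w * k + w) w"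
  have t: "?t \<noteq> 0" by (rule indet_t_nonzero)
  have v: "hl_v ?t m \<noteq> 0" for m
    by (rule hl_v_nonzero[OF indet_t_power_neq_1])
  have G: "G = hl_v ?t (n - w * k + w) / (hl_v ?t w * hl_v ?t (n - w * k))"
    unfolding G_def using gaussian_eq_hl_v[of ?t w "n - w * k + w", OF indet_t_power_neq_1] by simp
  have staircase: "staircase w s k = staircase_mid w s k 0"
    by (simp add: staircase_def staircase_mid_def)
  have "k \<le> n div w"
    using assms by (simp add: less_eq_div_iff_mult_less_eq mult.commute)
  then have zero: "conjugate (staircase_mid w s k g) n = 0" for g
    using assms by (simp add: conjugate_staircase_mid)
  \<comment> \<open>Both ratios follow from this: the Gaussian polynomial enters once, at \<open>g = 1\<close>, and each
    step adds the same power of \<open>t\<close>.\<close>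
  have P: "?P g = ?t ^ (g * ?C) * ?P 0 * (if g = 0 then 1 else G)" for g
  proof (cases "g = 0")
    case False
    let ?E = "\<Sum>i<n. i * conjugate (staircase w s k) i" and ?r = "n - w * k"
    have "hl_v ?t w ^ k = hl_v ?t w * hl_v ?t w ^ (k - 1)"
      using \<open>k > 0\<close> by (cases k) simp_all
    then have "?P g = ?t ^ (g * ?C + ?E) * hl_v ?t n / (hl_v ?t w * hl_v ?t w ^ (k - 1) * hl_v ?t ?r)"
      using False assms
      by (simp add: P_spec_eq zero hl_v_partition_conjugate_staircase_mid sum_conjugate_staircase_mid)
    also have "\<dots> = ?t ^ (g * ?C) * (?t ^ ?E * hl_v ?t n / (hl_v ?t w ^ (k - 1) * hl_v ?t (?r + w))) * G"
      unfolding G power_add using v by (simp add: mult_ac)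
    also have "?t ^ ?E * hl_v ?t n / (hl_v ?t w ^ (k - 1) * hl_v ?t (?r + w)) = ?P 0"
      using assms
      by (simp add: P_spec_eq zero hl_v_partition_conjugate_staircase_mid sum_conjugate_staircase_mid)
    finally show ?thesis using False by simp
  qed simp
  have P0: "?P 0 \<noteq> 0"
    using assms t v by (simp add: P_spec_eq zero hl_v_partition_conjugate_staircase_mid)
  have "G \<noteq> 0" using v by (simp add: G)
  have "?P (g + 1) / ?P g = ?t ^ ?C * (if g = 0 then G else 1)" for g
    using P0 \<open>G \<noteq> 0\<close> t by (simp add: P[of "Suc g"] P[of g] power_add)
  moreover have "?P g / P_spec n (conjugate (staircase w s k))
      = ?t ^ ((g * (w * k) * (w * k - 1)) div 2) * G" if "g \<in> {1..s}" for g
  proof -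
    have "even (w * k * (w * k - 1))" by (cases "w * k") auto
    then have "(g * (w * k) * (w * k - 1)) div 2 = g * ?C"
      by (simp add: div_mult_swap mult.assoc)
    then show ?thesis using that P0 by (simp add: P[of g] staircase)
  qed
  ultimately show ?thesis unfolding G_def by blast
qed

end
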